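(* Let $\mathbf k=(k_1,\dots,k_r)$ and $\mathbf l=(l_1,\dots,l_r)$ be $r$-tuples of positive integers and let $(\varepsilon_1,\dots,\varepsilon_r)\in\{\pm1\}^r$. Then $$\int_0^1\omega_0^{k_r}\omega_{\varepsilon_r}^{l_r}\cdots\omega_0^{k_1}\omega_{\varepsilon_1}^{l_1}=\int_0^1u_{\varepsilon_1}^{l_1}\omega_{-1}^{k_1}\cdots u_{\varepsilon_r}^{l_r}\omega_{-1}^{k_r},$$ where $u_{-1}=\omega_0$ and $u_1=\omega_0+\omega_1-\omega_{-1}$.
   Context: The differential forms are $\omega_0=\frac{dt}{t}$, $\omega_1=\frac{2t\,dt}{1-t^2}$, $\omega_{-1}=\frac{2\,dt}{1-t^2}$. For 1-forms $\eta_i=f_i(t)\,dt$ on $(0,1)$, the iterated integral is $\int_0^1\eta_1\cdots\eta_m=\int_{1>t_1>\cdots>t_m>0}f_1(t_1)\cdots f_m(t_m)\,dt_1\cdots dt_m$; a power $\eta^l$ means $\eta$ repeated $l$ times in succession. *)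

theory Defs
  imports "HOL-Analysis.Analysis"
begin

text \<open>
  A 1-form \<open>f(t) dt\<close> on \<open>(0,1)\<close> is represented by its coefficient function \<open>f\<close>, and a word
  \<open>\<eta>\<^sub>1 \<dots> \<eta>\<^sub>m\<close> of 1-forms by the list of the coefficient functions in the order in which they are
  written. The word is indexed from 0, so the \<open>i\<close>-th variable below is the \<open>t\<^sub>i\<^sub>+\<^sub>1\<close> of
  \<open>1 > t\<^sub>1 > \<dots> > t\<^sub>m > 0\<close>.
\<close>

definition open_simplex :: "nat \<Rightarrow> (nat \<Rightarrow> real) set" where
  "open_simplex m =
     {t \<in> {..<m} \<rightarrow>\<^sub>E {0<..<1}. \<forall>i j. i < j \<and> j < m \<longrightarrow> t i > t j}"

definition iterated_integrable :: "(real \<Rightarrow> real) list \<Rightarrow> bool" where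
  "iterated_integrable \<eta> \<longleftrightarrow>
     set_integrable (PiM {..<length \<eta>} (\<lambda>_. lborel)) (open_simplex (length \<eta>))
       (\<lambda>t. \<Prod>i<length \<eta>. (\<eta> ! i) (t i))"

text \<open>
  As with every Bochner integral, the value is the conventional 0 unless
  \<open>iterated_integrable \<eta>\<close> holds.
\<close>

definition iterated_integral :: "(real \<Rightarrow> real) list \<Rightarrow> real" where
  "iterated_integral \<eta> =
     (LINT t : open_simplex (length \<eta>) | PiM {..<length \<eta>} (\<lambda>_. lborel).
        \<Prod>i<length \<eta>. (\<eta> ! i) (t i))"

text \<open>
  Only the indices 0, 1, -1 of \<open>omega\<close> and 1, -1 of \<open>u_form\<close> are meaningful.
\<close>

definition omega :: "int \<Rightarrow> real \<Rightarrow> real" where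
  "omega e t =
     (if e = 0 then 1 / t
      else if e = 1 then 2 * t / (1 - t\<^sup>2)
      else if e = -1 then 2 / (1 - t\<^sup>2)
      else 0)"

definition u_form :: "int \<Rightarrow> real \<Rightarrow> real" where
  "u_form e t =
     (if e = -1 then omega 0 t
      else if e = 1 then omega 0 t + omega 1 t - omega (-1) t
      else 0)"

end

theory Submission
  imports Defs
begin

text \<open>
  The identity is the substitution \<open>t = (1 - s) / (1 + s)\<close>, applied to every variable at once. This
  decreasing involution of \<open>(0,1)\<close> maps the simplex \<open>t\<^sub>1 > \<dots> > t\<^sub>m\<close> to \<open>s\<^sub>1 < \<dots> < s\<^sub>m\<close>, so the word
  is read backwards. On forms, \<open>\<omega>\<^sub>0 = d log t\<close> becomes \<open>d log ((1 - s) / (1 + s)) = - \<omega>\<^sub>-\<^sub>1\<close>, hence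
  \<open>\<omega>\<^sub>-\<^sub>1\<close> becomes \<open>- \<omega>\<^sub>0 = - u\<^sub>-\<^sub>1\<close>, and \<open>\<omega>\<^sub>1 = - d log (1 - t\<^sup>2)\<close> becomes
  \<open>- d log (4 s / (1 + s)\<^sup>2) = - u\<^sub>1\<close>. The minus signs are those of the derivative of the
  substitution and disappear when the absolute value of the Jacobian is taken (\<open>flip_form_omega\<close>).

  The change of variables for arbitrary measurable forms is \<open>iterated_flip\<close>. It also
  carries integrability from one side to the other. On the product space it follows from its one-dimensional version \<open>distr_flip\<close>,
  because product measures are determined by their values on boxes.

  It remains to see that one of the integrals converges absolutely (\<open>iterated_integrableI\<close>). Every
  \<open>\<omega>\<close> is \<open>O(1 / (t (1 - t)))\<close>, which just fails to be integrable. The first form has no pole at 1 and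
  the last form no pole at 0, which gains the factors \<open>1 - t\<^sub>1\<close> and \<open>t\<^sub>m\<close>. These are the smallest
  of all \<open>1 - t\<^sub>i\<close> and of all \<open>t\<^sub>i\<close>, so each can be spread as an \<open>m\<close>-th root over all variables.
  The integrand is then dominated by a product of Beta integrands in the separate variables.
\<close>

section \<open>Change of variables in a finite product\<close>

text \<open>
  A substitution that acts on each coordinate separately, followed by a permutation of the
  coordinates, transforms a product measure as it transforms the factors: both sides agree on boxes.
  Only involutive permutations are considered, so that \<open>\<pi>\<close> is its own inverse.
\<close>

lemma PiM_distr_density_lborel:
  fixes w h :: "real \<Rightarrow> real" and \<pi> :: "'i \<Rightarrow> 'i"
  assumes I: "finite I"
    and \<pi>: "\<And>i. i \<in> I \<Longrightarrow> \<pi> i \<in> I" "\<And>i. i \<in> I \<Longrightarrow> \<pi> (\<pi> i) = i"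
    and w [measurable]: "w \<in> borel_measurable borel" and w0: "\<And>x. 0 \<le> w x"
    and h [measurable]: "h \<in> borel_measurable borel"
    and N: "N = distr (density lborel (\<lambda>x. ennreal (w x))) borel h"
    and \<sigma>: "sigma_finite_measure N"
  shows "distr (density (PiM I (\<lambda>_. lborel)) (\<lambda>t. ennreal (\<Prod>i\<in>I. w (t i))))
           (PiM I (\<lambda>_. lborel)) (\<lambda>t. \<lambda>i\<in>I. h (t (\<pi> i))) = PiM I (\<lambda>_. N)"
proof -
  interpret L: product_sigma_finite "\<lambda>_::'i. lborel :: real measure" by standard
  interpret P: product_sigma_finite "\<lambda>_::'i. N"
    unfolding product_sigma_finite_def using \<sigma> by simp
  have setsN: "sets N = sets borel" by (simp add: N)
  have bij: "bij_betw \<pi> I I"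
    by (rule bij_betw_byWitness[where f' = \<pi>]) (use \<pi> in auto)
  have mT [measurable]: "(\<lambda>t. \<lambda>i\<in>I. h (t (\<pi> i))) \<in> measurable (PiM I (\<lambda>_. lborel)) (PiM I (\<lambda>_. lborel))"
    by (rule measurable_restrict) (use \<pi> in measurable)
  have mw [measurable]: "(\<lambda>t. \<Prod>i\<in>I. w (t i)) \<in> borel_measurable (PiM I (\<lambda>_. lborel))"
    by measurable
  show ?thesis
  proof (rule P.PiM_eqI[OF I])
    show "sets (distr (density (PiM I (\<lambda>_. lborel)) (\<lambda>t. ennreal (\<Prod>i\<in>I. w (t i))))
           (PiM I (\<lambda>_. lborel)) (\<lambda>t. \<lambda>i\<in>I. h (t (\<pi> i)))) = sets (PiM I (\<lambda>_. N))"
      by (simp add: setsN cong: sets_PiM_cong)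
  next
    fix A assume "\<And>i. i \<in> I \<Longrightarrow> A i \<in> sets N"
    hence A [measurable]: "\<And>i. i \<in> I \<Longrightarrow> A i \<in> sets borel" by (simp add: setsN)
    have box: "Pi\<^sub>E I A \<in> sets (PiM I (\<lambda>_. lborel))"
      using I A by (intro sets_PiM_I_finite) auto
    have "emeasure (distr (density (PiM I (\<lambda>_. lborel)) (\<lambda>t. ennreal (\<Prod>i\<in>I. w (t i))))
           (PiM I (\<lambda>_. lborel)) (\<lambda>t. \<lambda>i\<in>I. h (t (\<pi> i)))) (Pi\<^sub>E I A) =
        (\<integral>\<^sup>+t. ennreal (\<Prod>i\<in>I. w (t i)) * indicator (Pi\<^sub>E I A) (\<lambda>i\<in>I. h (t (\<pi> i))) \<partial>PiM I (\<lambda>_. lborel))"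
      using box
      by (simp add: nn_integral_indicator[symmetric] nn_integral_distr nn_integral_density
            del: nn_integral_indicator)
    also have "\<dots> = (\<integral>\<^sup>+t. (\<Prod>j\<in>I. ennreal (w (t j)) * indicator (A (\<pi> j)) (h (t j))) \<partial>PiM I (\<lambda>_. lborel))"
    proof (rule nn_integral_cong)
      fix t :: "'i \<Rightarrow> real"
      have "indicator (Pi\<^sub>E I A) (\<lambda>i\<in>I. h (t (\<pi> i))) = (\<Prod>i\<in>I. indicator (A i) (h (t (\<pi> i))) :: ennreal)"
        using I by (auto simp: indicator_def PiE_iff prod_eq_1_iff intro!: prod_zero[symmetric])
      also have "\<dots> = (\<Prod>i\<in>I. indicator (A (\<pi> (\<pi> i))) (h (t (\<pi> i))))"
        using \<pi> by (intro prod.cong) auto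
      also have "\<dots> = (\<Prod>j\<in>I. indicator (A (\<pi> j)) (h (t j)))"
        by (rule prod.reindex_bij_betw[OF bij])
      finally show "ennreal (\<Prod>i\<in>I. w (t i)) * indicator (Pi\<^sub>E I A) (\<lambda>i\<in>I. h (t (\<pi> i))) =
          (\<Prod>j\<in>I. ennreal (w (t j)) * indicator (A (\<pi> j)) (h (t j)))"
        by (simp add: prod.distrib prod_ennreal w0)
    qed
    also have "\<dots> = (\<Prod>j\<in>I. \<integral>\<^sup>+x. ennreal (w x) * indicator (A (\<pi> j)) (h x) \<partial>lborel)"
      by (rule L.product_nn_integral_prod[OF I]) (use \<pi> A in measurable)
    also have "\<dots> = (\<Prod>j\<in>I. emeasure N (A (\<pi> j)))"
    proof (rule prod.cong[OF refl])
      fix j assume "j \<in> I"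
      hence [measurable]: "A (\<pi> j) \<in> sets borel" using \<pi> A by auto
      show "(\<integral>\<^sup>+x. ennreal (w x) * indicator (A (\<pi> j)) (h x) \<partial>lborel) = emeasure N (A (\<pi> j))"
        unfolding N
        by (simp add: nn_integral_indicator[symmetric] nn_integral_distr nn_integral_density
            del: nn_integral_indicator)
    qed
    also have "\<dots> = (\<Prod>i\<in>I. emeasure N (A i))"
      by (rule prod.reindex_bij_betw[OF bij])
    finally show "emeasure (distr (density (PiM I (\<lambda>_. lborel)) (\<lambda>t. ennreal (\<Prod>i\<in>I. w (t i))))
           (PiM I (\<lambda>_. lborel)) (\<lambda>t. \<lambda>i\<in>I. h (t (\<pi> i)))) (Pi\<^sub>E I A) = (\<Prod>i\<in>I. emeasure N (A i))" .
  qed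
qed

text \<open>
  The form for integrals is used for the same \<open>N\<close>, the uniform distribution on the unit interval, with
  two different representations: as the plain restriction of Lebesgue measure, and as its image
  under \<open>flip\<close>. Comparing the two gives the change of variables.
\<close>

lemma integral_PiM_distr_density_lborel:
  fixes w h :: "real \<Rightarrow> real" and \<pi> :: "'i \<Rightarrow> 'i" and F :: "('i \<Rightarrow> real) \<Rightarrow> real"
  assumes I: "finite I"
    and \<pi>: "\<And>i. i \<in> I \<Longrightarrow> \<pi> i \<in> I" "\<And>i. i \<in> I \<Longrightarrow> \<pi> (\<pi> i) = i"
    and w [measurable]: "w \<in> borel_measurable borel" and w0: "\<And>x. 0 \<le> w x"
    and h [measurable]: "h \<in> borel_measurable borel"
    and N: "N = distr (density lborel (\<lambda>x. ennreal (w x))) borel h"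
    and \<sigma>: "sigma_finite_measure N"
    and F [measurable]: "F \<in> borel_measurable (PiM I (\<lambda>_. lborel))"
  shows "integrable (PiM I (\<lambda>_. N)) F \<longleftrightarrow>
         integrable (PiM I (\<lambda>_. lborel)) (\<lambda>t. (\<Prod>i\<in>I. w (t i)) * F (\<lambda>i\<in>I. h (t (\<pi> i))))"
    and "integral\<^sup>L (PiM I (\<lambda>_. N)) F =
         integral\<^sup>L (PiM I (\<lambda>_. lborel)) (\<lambda>t. (\<Prod>i\<in>I. w (t i)) * F (\<lambda>i\<in>I. h (t (\<pi> i))))"
proof -
  have mT [measurable]: "(\<lambda>t. \<lambda>i\<in>I. h (t (\<pi> i))) \<in> measurable (PiM I (\<lambda>_. lborel)) (PiM I (\<lambda>_. lborel))"
    by (rule measurable_restrict) (use \<pi> in measurable)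
  have mw [measurable]: "(\<lambda>t. \<Prod>i\<in>I. w (t i)) \<in> borel_measurable (PiM I (\<lambda>_. lborel))"
    by measurable
  have eq: "PiM I (\<lambda>_. N) = distr (density (PiM I (\<lambda>_. lborel)) (\<lambda>t. ennreal (\<Prod>i\<in>I. w (t i))))
           (PiM I (\<lambda>_. lborel)) (\<lambda>t. \<lambda>i\<in>I. h (t (\<pi> i)))"
    by (rule PiM_distr_density_lborel[OF I \<pi> w w0 h N \<sigma>, symmetric])
  show "integrable (PiM I (\<lambda>_. N)) F \<longleftrightarrow>
         integrable (PiM I (\<lambda>_. lborel)) (\<lambda>t. (\<Prod>i\<in>I. w (t i)) * F (\<lambda>i\<in>I. h (t (\<pi> i))))"
    unfolding eq by (subst integrable_distr_eq; (subst integrable_density)?) (simp_all add: prod_nonneg w0)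
  show "integral\<^sup>L (PiM I (\<lambda>_. N)) F =
         integral\<^sup>L (PiM I (\<lambda>_. lborel)) (\<lambda>t. (\<Prod>i\<in>I. w (t i)) * F (\<lambda>i\<in>I. h (t (\<pi> i))))"
    unfolding eq by (subst integral_distr; (subst integral_density)?) (simp_all add: prod_nonneg w0)
qed

section \<open>The involution of the unit interval\<close>

definition flip :: "real \<Rightarrow> real" where
  "flip t = (1 - t) / (1 + t)"

text \<open>The absolute value of the derivative of \<open>flip\<close>.\<close>

definition flip_jacobian :: "real \<Rightarrow> real" where
  "flip_jacobian t = 2 / (1 + t)\<^sup>2"

lemma flip_measurable [measurable]: "flip \<in> borel_measurable borel"
  unfolding flip_def[abs_def] by measurable

lemma flip_jacobian_measurable [measurable]: "flip_jacobian \<in> borel_measurable borel"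
  unfolding flip_jacobian_def[abs_def] by measurable

lemma flip_in_unit_iff: "t \<in> {0..1} \<Longrightarrow> flip t \<in> {0<..<1} \<longleftrightarrow> t \<in> {0<..<1}"
  by (auto simp: flip_def field_simps)

lemma flip_less_iff: "s \<in> {0..1} \<Longrightarrow> t \<in> {0..1} \<Longrightarrow> flip s < flip t \<longleftrightarrow> t < s"
  by (auto simp: flip_def field_simps)

text \<open>
  The substitution rule for nonnegative integrals is stated for increasing functions, so \<open>flip\<close> is
  written as the reflection \<open>t \<mapsto> 1 - t\<close> followed by the increasing function \<open>t / (2 - t)\<close>. The
  weight lives on the closed interval, which \<open>flip\<close> maps onto itself.
\<close>

lemma distr_flip:
  "distr (density lborel (\<lambda>t. ennreal (indicator {0..1} t * flip_jacobian t))) borel flip =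
   density lborel (\<lambda>t. ennreal (indicator {0..1} t))"
proof (rule measure_eqI)
  fix A assume "A \<in> sets (distr (density lborel (\<lambda>t. ennreal (indicator {0..1} t * flip_jacobian t))) borel flip)"
  hence A [measurable]: "A \<in> sets borel" by simp
  define g g' where "g = (\<lambda>t::real. t / (2 - t))" and "g' = (\<lambda>t::real. 2 / (2 - t)\<^sup>2)"
  have "emeasure (density lborel (\<lambda>t. ennreal (indicator {0..1} t))) A =
      (\<integral>\<^sup>+x. ennreal (indicator A x) * indicator {g 0..g 1} x \<partial>lborel)"
    by (auto simp: emeasure_density g_def indicator_def intro!: nn_integral_cong)
  also have "\<dots> = (\<integral>\<^sup>+x. ennreal (indicator A x * indicator {g 0..g 1} x) \<partial>lborel)"
    by (auto simp: indicator_def intro!: nn_integral_cong)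
  also have "\<dots> = (\<integral>\<^sup>+x. ennreal (indicator A (g x) * g' x * indicator {0..1} x) \<partial>lborel)"
  proof (rule nn_integral_substitution)
    fix x :: real assume "x \<in> {0..1}"
    thus "(g has_real_derivative g' x) (at x)"
      unfolding g_def g'_def by (auto intro!: derivative_eq_intros simp: power2_eq_square)
  qed (auto simp: g'_def set_borel_measurable_def intro!: continuous_intros)
  also have "\<dots> = (\<integral>\<^sup>+t. ennreal (indicator A (g (1 + (-1) * t)) * g' (1 + (-1) * t) * indicator {0..1} (1 + (-1) * t)) \<partial>lborel)"
    by (subst nn_integral_real_affine[where c = "-1" and t = 1]) (auto simp: g_def g'_def)
  also have "\<dots> = (\<integral>\<^sup>+t. ennreal (indicator {0..1} t * flip_jacobian t) * indicator A (flip t) \<partial>lborel)"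
    by (auto simp: indicator_def g_def g'_def flip_def flip_jacobian_def algebra_simps intro!: nn_integral_cong)
  also have "\<dots> = emeasure (distr (density lborel (\<lambda>t. ennreal (indicator {0..1} t * flip_jacobian t))) borel flip) A"
    by (simp add: nn_integral_indicator[symmetric] nn_integral_distr nn_integral_density
            del: nn_integral_indicator)
  finally show "emeasure (distr (density lborel (\<lambda>t. ennreal (indicator {0..1} t * flip_jacobian t))) borel flip) A =
     emeasure (density lborel (\<lambda>t. ennreal (indicator {0..1} t))) A" ..
qed simp

section \<open>Iterated integrals\<close>

lemma open_simplex_measurable [measurable]:
  "open_simplex m \<in> sets (PiM {..<m} (\<lambda>_. lborel))"
proof -
  have "open_simplex m = (\<Pi>\<^sub>E i\<in>{..<m}. {0<..<1}) \<inter>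
      {t \<in> space (PiM {..<m} (\<lambda>_. lborel)). \<forall>j\<in>{..<m}. \<forall>i\<in>{..<j}. t j < t i}"
    by (fastforce simp: open_simplex_def space_PiM PiE_iff extensional_def)
  also have "\<dots> \<in> sets (PiM {..<m} (\<lambda>_. lborel))"
  proof (intro sets.Int sets_PiM_I_finite sets.sets_Collect_finite_All)
    fix i j assume "j \<in> {..<m}" "i \<in> {..<j}"
    hence [measurable]: "j \<in> {..<m}" "i \<in> {..<m}" by auto
    show "{t \<in> space (PiM {..<m} (\<lambda>_. lborel)). t j < (t i :: real)} \<in> sets (PiM {..<m} (\<lambda>_. lborel))"
      by measurable
  qed auto
  finally show ?thesis .
qed

lemma iterated_cong:
  assumes len: "length \<eta> = length \<zeta>"
    and eq: "\<And>i t. i < length \<zeta> \<Longrightarrow> t \<in> {0<..<1} \<Longrightarrow> (\<eta> ! i) t = (\<zeta> ! i) t"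
  shows "iterated_integrable \<eta> \<longleftrightarrow> iterated_integrable \<zeta>"
    and "iterated_integral \<eta> = iterated_integral \<zeta>"
proof -
  have *: "indicator (open_simplex (length \<zeta>)) t *\<^sub>R (\<Prod>i<length \<zeta>. (\<eta> ! i) (t i)) =
           indicator (open_simplex (length \<zeta>)) t *\<^sub>R (\<Prod>i<length \<zeta>. (\<zeta> ! i) (t i))" for t
  proof (cases "t \<in> open_simplex (length \<zeta>)")
    case True
    hence "(\<Prod>i<length \<zeta>. (\<eta> ! i) (t i)) = (\<Prod>i<length \<zeta>. (\<zeta> ! i) (t i))"
      by (intro prod.cong eq) (auto simp: open_simplex_def PiE_iff)
    thus ?thesis by simp
  qed simp
  show "iterated_integrable \<eta> \<longleftrightarrow> iterated_integrable \<zeta>"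
    unfolding iterated_integrable_def set_integrable_def len * ..
  show "iterated_integral \<eta> = iterated_integral \<zeta>"
    unfolding iterated_integral_def set_lebesgue_integral_def len * ..
qed

text \<open>
  The closed cube is the support of the weight in \<open>distr_flip\<close>; the equivalence holds on all of it
  because \<open>flip\<close> only exchanges the two endpoints, which the simplex excludes.
\<close>

lemma flip_reverse_open_simplex:
  assumes "t \<in> {..<m} \<rightarrow>\<^sub>E {0..1}"
  shows "(\<lambda>i\<in>{..<m}. flip (t (m - Suc i))) \<in> open_simplex m \<longleftrightarrow> t \<in> open_simplex m"
proof -
  have t: "t i \<in> {0..1}" if "i < m" for i
    using PiE_mem[OF assms, of i] that by simp
  have "(\<forall>i<m. flip (t (m - Suc i)) \<in> {0<..<1}) \<longleftrightarrow> (\<forall>i<m. t (m - Suc i) \<in> {0<..<1})"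
    by (intro all_cong flip_in_unit_iff t) simp
  also have "\<dots> \<longleftrightarrow> (\<forall>i<m. t i \<in> {0<..<1})"
  proof safe
    fix i assume *: "\<forall>i<m. t (m - Suc i) \<in> {0<..<1}" "i < m"
    show "t i \<in> {0<..<1}" using *(1)[rule_format, of "m - Suc i"] *(2) by simp
  qed auto
  finally have 1: "(\<forall>i<m. flip (t (m - Suc i)) \<in> {0<..<1}) \<longleftrightarrow> (\<forall>i<m. t i \<in> {0<..<1})" .
  have "(\<forall>i j. i < j \<and> j < m \<longrightarrow> flip (t (m - Suc i)) > flip (t (m - Suc j))) \<longleftrightarrow>
        (\<forall>i j. i < j \<and> j < m \<longrightarrow> t (m - Suc j) > t (m - Suc i))"
    by (intro all_cong1 imp_cong refl flip_less_iff t) simp_all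
  also have "\<dots> \<longleftrightarrow> (\<forall>i j. i < j \<and> j < m \<longrightarrow> t i > t j)"
  proof (intro iffI allI impI)
    fix i j assume *: "\<forall>i j. i < j \<and> j < m \<longrightarrow> t (m - Suc j) > t (m - Suc i)" "i < j \<and> j < m"
    show "t i > t j"
      using *(1)[rule_format, of "m - Suc j" "m - Suc i"] *(2)
      by (simp add: Suc_diff_Suc diff_less_mono2)
  next
    fix i j assume *: "\<forall>i j. i < j \<and> j < m \<longrightarrow> t i > t j" "i < j \<and> j < m"
    show "t (m - Suc j) > t (m - Suc i)"
      using *(1)[rule_format, of "m - Suc j" "m - Suc i"] *(2) by auto
  qed
  finally have 2: "(\<forall>i j. i < j \<and> j < m \<longrightarrow> flip (t (m - Suc i)) > flip (t (m - Suc j))) \<longleftrightarrow>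
      (\<forall>i j. i < j \<and> j < m \<longrightarrow> t i > t j)" .
  have 3: "(\<forall>i j. i < j \<and> j < m \<longrightarrow> (\<lambda>i\<in>{..<m}. flip (t (m - Suc i))) i > (\<lambda>i\<in>{..<m}. flip (t (m - Suc i))) j)
     \<longleftrightarrow> (\<forall>i j. i < j \<and> j < m \<longrightarrow> flip (t (m - Suc i)) > flip (t (m - Suc j)))"
    by (auto simp: restrict_def)
  have "t \<in> extensional {..<m}" using assms unfolding PiE_iff by (rule conjunct2)
  hence "(\<lambda>i\<in>{..<m}. flip (t (m - Suc i))) \<in> {..<m} \<rightarrow>\<^sub>E {0<..<1} \<longleftrightarrow> t \<in> {..<m} \<rightarrow>\<^sub>E {0<..<1}"
    using 1 by (simp add: PiE_iff Ball_def)
  thus ?thesis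
    unfolding open_simplex_def mem_Collect_eq 3 2 by (rule conj_cong) (rule refl)
qed

text \<open>The pullback of the form \<open>f(t) dt\<close> under \<open>flip\<close>, with the orientation restored.\<close>

definition flip_form :: "(real \<Rightarrow> real) \<Rightarrow> real \<Rightarrow> real" where
  "flip_form f t = f (flip t) * flip_jacobian t"

text \<open>
  The integrand of \<open>\<eta>\<close>, cut off outside the simplex, is integrated over the cube against the
  product of uniform distributions. Representing each of these as an image under \<open>flip\<close> and
  reversing the coordinates gives back the simplex, the word read backwards, and one Jacobian for
  each form. Coordinate \<open>i\<close> goes to \<open>m - Suc i\<close>, because words are indexed from 0.
\<close>

lemma iterated_flip:
  assumes meas: "\<And>f. f \<in> set \<eta> \<Longrightarrow> f \<in> borel_measurable borel"
  shows "iterated_integrable (map flip_form (rev \<eta>)) \<longleftrightarrow> iterated_integrable \<eta>"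
    and "iterated_integral (map flip_form (rev \<eta>)) = iterated_integral \<eta>"
proof -
  define m where "m = length \<eta>"
  define F where "F = (\<lambda>t. indicator (open_simplex m) t *\<^sub>R (\<Prod>i<m. (\<eta> ! i) (t i)) :: real)"
  define G where "G = (\<lambda>t. indicator (open_simplex m) t *\<^sub>R (\<Prod>i<m. (map flip_form (rev \<eta>) ! i) (t i)) :: real)"
  define N :: "real measure" where "N = density lborel (\<lambda>t. ennreal (indicator {0..1} t))"
  let ?P = "PiM {..<m} (\<lambda>_. lborel :: real measure)"
  have [measurable]: "(\<eta> ! i) \<in> borel_measurable borel" if "i < m" for i
    using meas that by (simp add: m_def)
  have [measurable]: "F \<in> borel_measurable ?P"
    unfolding F_def by measurable
  have "finite_measure N"
    unfolding N_def by (rule finite_measureI) (simp add: emeasure_density ennreal_indicator)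
  hence \<sigma>: "sigma_finite_measure N" by (simp add: finite_measure.axioms)
  have N1: "N = distr (density lborel (\<lambda>t. ennreal (indicator {0..1} t))) borel (\<lambda>x. x)"
    unfolding N_def by (rule measure_eqI) (auto simp: emeasure_distr)
  have N2: "N = distr (density lborel (\<lambda>t. ennreal (indicator {0..1} t * flip_jacobian t))) borel flip"
    unfolding N_def by (rule distr_flip[symmetric])
  \<comment> \<open>The restriction to \<open>{..<m}\<close> does nothing to points of the product space, and the weight is 1 on
    the simplex.\<close>
  have F: "(\<Prod>i<m. indicator {0..1} (t i)) * F (\<lambda>i\<in>{..<m}. t i) = F t" if "t \<in> space ?P" for t
  proof -
    have "(\<lambda>i\<in>{..<m}. t i) = t" using that by (auto simp: space_PiM)
    moreover have "(\<Prod>i<m. indicator {0..1} (t i) :: real) = 1" if "t \<in> open_simplex m"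
      using that by (intro prod.neutral) (auto simp: open_simplex_def indicator_def PiE_iff less_imp_le)
    ultimately show ?thesis by (auto simp: F_def indicator_def)
  qed
  have G: "(\<Prod>i<m. indicator {0..1} (t i) * flip_jacobian (t i)) * F (\<lambda>i\<in>{..<m}. flip (t (m - Suc i))) = G t"
    if "t \<in> space ?P" for t
  proof (cases "t \<in> {..<m} \<rightarrow>\<^sub>E {0..1}")
    case True
    have "(\<Prod>i<m. (map flip_form (rev \<eta>) ! i) (t i)) =
        (\<Prod>i<m. (\<eta> ! (m - Suc i)) (flip (t i))) * (\<Prod>i<m. flip_jacobian (t i))"
      by (simp add: prod.distrib[symmetric] flip_form_def rev_nth m_def)
    also have "(\<Prod>i<m. (\<eta> ! (m - Suc i)) (flip (t i))) = (\<Prod>i<m. (\<eta> ! i) (flip (t (m - Suc i))))"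
      by (rule prod.reindex_bij_witness[of _ "\<lambda>i. m - Suc i" "\<lambda>i. m - Suc i"]) auto
    also have "\<dots> = (\<Prod>i<m. (\<eta> ! i) ((\<lambda>i\<in>{..<m}. flip (t (m - Suc i))) i))"
      by (intro prod.cong) auto
    finally have "(\<Prod>i<m. (map flip_form (rev \<eta>) ! i) (t i)) =
       (\<Prod>i<m. (\<eta> ! i) ((\<lambda>i\<in>{..<m}. flip (t (m - Suc i))) i)) * (\<Prod>i<m. flip_jacobian (t i))" .
    moreover have "(\<Prod>i<m. indicator {0..1} (t i) * flip_jacobian (t i)) = (\<Prod>i<m. flip_jacobian (t i))"
      using True by (intro prod.cong) (auto simp: PiE_iff)
    ultimately show ?thesis
      unfolding F_def G_def using flip_reverse_open_simplex[OF True] by (simp add: indicator_def)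
  next
    case False
    with that have "\<exists>i<m. t i \<notin> {0..1}"
      by (auto simp: space_PiM PiE_iff simp del: atLeastAtMost_iff)
    then obtain i where i: "i < m" "t i \<notin> {0..1}" by blast
    hence "(\<Prod>i<m. indicator {0..1} (t i) * flip_jacobian (t i)) = 0"
      by (intro prod_zero bexI[of _ i]) auto
    moreover have "t \<notin> open_simplex m"
          proof
      assume "t \<in> open_simplex m"
      hence "t i \<in> {0<..<1}" using i by (auto simp: open_simplex_def PiE_iff)
      thus False using i by simp
    qed
    ultimately show ?thesis by (simp add: G_def)
  qed
  have J0: "0 \<le> indicator {0..1} x * flip_jacobian x" for x
    by (simp add: flip_jacobian_def)
  note 1 = integral_PiM_distr_density_lborel[where \<pi> = "\<lambda>i. i", OF _ _ _ _ _ _ N1 \<sigma> \<open>F \<in> _\<close>]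
  note 2 = integral_PiM_distr_density_lborel[where \<pi> = "\<lambda>i. m - Suc i", OF _ _ _ _ J0 _ N2 \<sigma> \<open>F \<in> _\<close>]
  have "integrable (PiM {..<m} (\<lambda>_. N)) F \<longleftrightarrow> integrable ?P F"
    by (subst 1) (auto simp: F intro!: Bochner_Integration.integrable_cong)
  moreover have "integrable (PiM {..<m} (\<lambda>_. N)) F \<longleftrightarrow> integrable ?P G"
    by (subst 2) (auto simp: G intro!: Bochner_Integration.integrable_cong)
  ultimately show "iterated_integrable (map flip_form (rev \<eta>)) \<longleftrightarrow> iterated_integrable \<eta>"
    by (simp add: iterated_integrable_def set_integrable_def F_def G_def m_def)
  have "integral\<^sup>L (PiM {..<m} (\<lambda>_. N)) F = integral\<^sup>L ?P F"
    by (subst 1) (auto simp: F intro!: Bochner_Integration.integral_cong)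
  moreover have "integral\<^sup>L (PiM {..<m} (\<lambda>_. N)) F = integral\<^sup>L ?P G"
    by (subst 2) (auto simp: G intro!: Bochner_Integration.integral_cong)
  ultimately show "iterated_integral (map flip_form (rev \<eta>)) = iterated_integral \<eta>"
    by (simp add: iterated_integral_def set_lebesgue_integral_def F_def G_def m_def)
qed

section \<open>Convergence\<close>

text \<open>
  With \<open>\<delta> = 1 / m\<close>, the integrand is at most
  \<open>(1 - t\<^sub>0) t\<^sub>m\<^sub>-\<^sub>1 \<Prod> C / (t\<^sub>i (1 - t\<^sub>i))\<close> on the simplex, and
  \<open>1 - t\<^sub>0 = \<Prod> (1 - t\<^sub>0)\<^sup>\<delta> \<le> \<Prod> (1 - t\<^sub>i)\<^sup>\<delta>\<close>, and similarly for \<open>t\<^sub>m\<^sub>-\<^sub>1\<close>. This leaves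
  \<open>\<Prod> C (t\<^sub>i (1 - t\<^sub>i))\<^sup>\<delta>\<^sup>-\<^sup>1\<close>, a product of integrable functions. The two gains
  multiply because the first and the last form are different factors of the integrand.
\<close>

lemma iterated_integrableI:
  assumes meas: "\<And>f. f \<in> set \<eta> \<Longrightarrow> f \<in> borel_measurable borel"
    and len: "length \<eta> \<noteq> 1"
    and bound: "\<And>f t. f \<in> set \<eta> \<Longrightarrow> t \<in> {0<..<1} \<Longrightarrow> \<bar>f t\<bar> \<le> C / (t * (1 - t))"
    and first: "\<And>t. \<eta> \<noteq> [] \<Longrightarrow> t \<in> {0<..<1} \<Longrightarrow> \<bar>hd \<eta> t\<bar> \<le> C / t"
    and last: "\<And>t. \<eta> \<noteq> [] \<Longrightarrow> t \<in> {0<..<1} \<Longrightarrow> \<bar>last \<eta> t\<bar> \<le> C / (1 - t)"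
  shows "iterated_integrable \<eta>"
proof -
  define m where "m = length \<eta>"
  define \<delta> where "\<delta> = 1 / real m"
  define g where "g = (\<lambda>t. indicator {0..1} t *\<^sub>R (C * (t powr (\<delta> - 1) * (1 - t) powr (\<delta> - 1))) :: real)"
  interpret L: product_sigma_finite "\<lambda>_::nat. lborel :: real measure" by standard
  have [measurable]: "(\<eta> ! i) \<in> borel_measurable borel" if "i < m" for i
    using meas that by (simp add: m_def)
  have dom: "\<bar>\<Prod>i<m. (\<eta> ! i) (t i)\<bar> \<le> (\<Prod>i<m. g (t i))" if t: "t \<in> open_simplex m" for t
  proof (cases "m = 0")
    case False
    with len have m: "m \<ge> 2" unfolding m_def by linarith
    have t01: "0 < t i" "t i < 1" if "i < m" for i
      using t that by (auto simp: open_simplex_def PiE_iff)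
    have t_first: "t i \<le> t 0" if "i < m" for i
      using t that by (cases "i = 0") (auto simp: open_simplex_def intro: less_imp_le)
    have t_last: "t (m - 1) \<le> t i" if "i < m" for i
      using t that by (cases "i = m - 1") (auto simp: open_simplex_def intro!: less_imp_le)
    \<comment> \<open>\<open>c\<close> collects the gains at the two ends of the word, \<open>d\<close> is the bound common to all forms.\<close>
    define c where "c = (\<lambda>i. (if i = 0 then 1 - t 0 else 1) * (if i = m - 1 then t (m - 1) else 1))"
    define d where "d = (\<lambda>i. C / (t i * (1 - t i)))"
    have "\<bar>\<Prod>i<m. (\<eta> ! i) (t i)\<bar> = (\<Prod>i<m. \<bar>(\<eta> ! i) (t i)\<bar>)" by (rule abs_prod)
    also have "\<dots> \<le> (\<Prod>i<m. c i * d i)"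
    proof (rule prod_mono, safe)
      fix i assume i: "i < m"
      have ne: "\<eta> \<noteq> []" using m by (auto simp: m_def)
      consider "i = 0" | "i = m - 1" "i \<noteq> 0" | "i \<noteq> 0" "i \<noteq> m - 1" by blast
      thus "\<bar>(\<eta> ! i) (t i)\<bar> \<le> c i * d i"
      proof cases
        case 1
        thus ?thesis
          using first[OF ne, of "t 0"] t01[of 0] m ne
          by (simp add: c_def d_def hd_conv_nth)
      next
        case 2
        thus ?thesis
          using last[OF ne, of "t i"] t01[of i] m ne i
          by (simp add: c_def d_def last_conv_nth m_def)
      next
        case 3
        thus ?thesis
          using bound[of "\<eta> ! i" "t i"] t01[of i] i by (simp add: c_def d_def m_def)
      qed
    qed auto
    also have "\<dots> = ((1 - t 0) * t (m - 1)) * (\<Prod>i<m. d i)"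
      using m by (simp add: c_def prod.distrib)
    also have "\<dots> \<le> (\<Prod>i<m. (1 - t i) powr \<delta> * t i powr \<delta>) * (\<Prod>i<m. d i)"
    proof (rule mult_right_mono)
      have "x = (\<Prod>i<m. x powr \<delta>)" if "0 < x" for x :: real
        using that m by (simp add: \<delta>_def powr_power)
      hence "(1 - t 0) * t (m - 1) = (\<Prod>i<m. (1 - t 0) powr \<delta>) * (\<Prod>i<m. t (m - 1) powr \<delta>)"
        using t01[of 0] t01[of "m - 1"] m by simp
      also have "\<dots> = (\<Prod>i<m. (1 - t 0) powr \<delta> * t (m - 1) powr \<delta>)"
        by (simp only: prod.distrib)
      also have "\<dots> \<le> (\<Prod>i<m. (1 - t i) powr \<delta> * t i powr \<delta>)"
        using t01 t_first t_last m
        by (intro prod_mono conjI mult_mono powr_mono2) (auto simp: \<delta>_def less_imp_le)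
      finally show "(1 - t 0) * t (m - 1) \<le> (\<Prod>i<m. (1 - t i) powr \<delta> * t i powr \<delta>)" .
      have "0 \<le> d i" if "i < m" for i
        using bound[of "\<eta> ! i" "t i"] t01[OF that] that by (simp add: d_def m_def)
      thus "0 \<le> (\<Prod>i<m. d i)" by (intro prod_nonneg) auto
    qed
    also have "\<dots> = (\<Prod>i<m. (1 - t i) powr \<delta> * t i powr \<delta> * d i)"
      by (simp only: prod.distrib)
    also have "\<dots> = (\<Prod>i<m. g (t i))"
      using t01 by (intro prod.cong) (auto simp: g_def d_def powr_diff field_simps less_imp_le)
    finally show ?thesis .
  qed simp
  have "integrable (PiM {..<m} (\<lambda>_. lborel)) (\<lambda>t. \<Prod>i<m. g (t i))"
  proof (rule L.product_integrable_prod)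
    fix i assume "i \<in> {..<m}"
    hence "\<delta> > 0" by (simp add: \<delta>_def)
    thus "integrable lborel g"
      using integrable_mult_right[OF integrable_Beta[of \<delta> \<delta>, unfolded set_integrable_def], of C]
      by (simp add: g_def mult_ac)
  qed simp
  hence "integrable (PiM {..<m} (\<lambda>_. lborel))
          (\<lambda>t. indicator (open_simplex m) t *\<^sub>R (\<Prod>i<m. (\<eta> ! i) (t i)))"
  proof (rule Bochner_Integration.integrable_bound)
    show "(\<lambda>t. indicator (open_simplex m) t *\<^sub>R (\<Prod>i<m. (\<eta> ! i) (t i)))
        \<in> borel_measurable (PiM {..<m} (\<lambda>_. lborel))"
      by measurable
    show "AE t in PiM {..<m} (\<lambda>_. lborel). norm (indicator (open_simplex m) t *\<^sub>R (\<Prod>i<m. (\<eta> ! i) (t i)))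
       \<le> norm (\<Prod>i<m. g (t i))"
      using dom by (intro always_eventually) (force simp: indicator_def)
  qed
  thus ?thesis by (simp add: iterated_integrable_def set_integrable_def m_def)
qed

section \<open>The duality\<close>

lemma omega_measurable [measurable]: "omega e \<in> borel_measurable borel"
  unfolding omega_def[abs_def] by measurable

text \<open>
  The letters \<open>0, 1, -1\<close> name the forms \<open>\<omega>\<^sub>0, \<omega>\<^sub>1, \<omega>\<^sub>-\<^sub>1\<close>, and \<open>dual_form\<close> names their images under the
  substitution. Working with words in these letters turns the identity into list reversal.
\<close>

definition dual_form :: "int \<Rightarrow> real \<Rightarrow> real" where
  "dual_form e = (if e = 0 then omega (-1) else u_form e)"

lemma flip_form_omega:
  assumes e: "e \<in> {0, 1, -1}" and t: "t \<in> {0<..<1}"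
  shows "flip_form (omega e) t = dual_form e t"
proof -
  have "0 < 1 - t" "0 < 1 + t" "0 < t" using t by auto
  have J: "1 - (flip t)\<^sup>2 = 4 * t / (1 + t)\<^sup>2" "1 - t\<^sup>2 = (1 - t) * (1 + t)"
  proof -
    have "1 - (flip t)\<^sup>2 = ((1 + t)\<^sup>2 - (1 - t)\<^sup>2) / (1 + t)\<^sup>2"
      using \<open>0 < 1 + t\<close> by (simp add: flip_def power_divide diff_divide_distrib[of "(1 + t)\<^sup>2" "(1 - t)\<^sup>2"])
    thus "1 - (flip t)\<^sup>2 = 4 * t / (1 + t)\<^sup>2" by (simp add: power2_eq_square algebra_simps)
  qed (simp add: algebra_simps power2_eq_square)
  consider "e = 0" | "e = 1" | "e = -1" using e by auto
  thus ?thesis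
  proof cases
    case 1
    have "flip_form (omega e) t = 2 / ((1 - t) * (1 + t))"
      using 1 \<open>0 < 1 - t\<close> \<open>0 < 1 + t\<close>
      by (simp add: flip_form_def omega_def flip_jacobian_def flip_def divide_simps)
        (simp add: algebra_simps power2_eq_square)
    thus ?thesis using 1 by (simp add: dual_form_def omega_def J)
  next
    case 2
    have "flip_form (omega e) t = (1 - t) / (t * (1 + t))"
      using 2 \<open>0 < 1 - t\<close> \<open>0 < 1 + t\<close> \<open>0 < t\<close>
      by (simp add: flip_form_def omega_def J flip_jacobian_def) (simp add: flip_def divide_simps power2_eq_square)
    also have "\<dots> = 1 / t + 2 * t / ((1 - t) * (1 + t)) - 2 / ((1 - t) * (1 + t))"
      using \<open>0 < 1 - t\<close> \<open>0 < 1 + t\<close> \<open>0 < t\<close>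
      by (simp add: divide_simps) (simp add: algebra_simps)
    finally show ?thesis using 2 by (simp add: dual_form_def u_form_def omega_def J)
  next
    case 3
    thus ?thesis using \<open>0 < 1 + t\<close> \<open>0 < t\<close>
      by (simp add: flip_form_def dual_form_def u_form_def omega_def J flip_jacobian_def)
  qed
qed

lemma iterated_duality:
  assumes "set es \<subseteq> {0, 1, -1}"
  shows "iterated_integrable (map dual_form (rev es)) \<longleftrightarrow> iterated_integrable (map omega es)"
    and "iterated_integral (map dual_form (rev es)) = iterated_integral (map omega es)"
proof -
  have nth: "(map dual_form (rev es) ! i) t = (map flip_form (rev (map omega es)) ! i) t"
    if "i < length (map flip_form (rev (map omega es)))" "t \<in> {0<..<1}" for i t
  proof -
    have "rev es ! i \<in> set (rev es)" using that by (intro nth_mem) simp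
    with assms have "rev es ! i \<in> {0, 1, -1}" by auto
    thus ?thesis using that by (simp add: rev_map flip_form_omega)
  qed
  note 1 = iterated_cong[of "map dual_form (rev es)" "map flip_form (rev (map omega es))", OF _ nth]
  note 2 = iterated_flip[of "map omega es"]
  show "iterated_integrable (map dual_form (rev es)) \<longleftrightarrow> iterated_integrable (map omega es)"
    by (subst 1; (subst 2)?) auto
  show "iterated_integral (map dual_form (rev es)) = iterated_integral (map omega es)"
    by (subst 1; (subst 2)?) auto
qed

text \<open>
  This is the usual admissibility condition: a leading \<open>\<omega>\<^sub>0\<close> avoids the pole at 1, and a final
  \<open>\<omega>\<^sub>\<plusminus>\<^sub>1\<close> avoids the pole at 0.
\<close>

lemma iterated_integrable_omega:
  assumes es: "set es \<subseteq> {0, 1, -1}"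
    and adm: "es \<noteq> [] \<Longrightarrow> hd es = 0 \<and> last es \<noteq> 0"
  shows "iterated_integrable (map omega es)"
proof (rule iterated_integrableI[where C = 2])
  have w0: "\<bar>omega 0 t\<bar> \<le> 2 / t" if "t \<in> {0<..<1}" for t
    using that by (simp add: omega_def divide_simps)
  have w1: "\<bar>omega e t\<bar> \<le> 2 / (1 - t)" if "t \<in> {0<..<1}" "e \<in> {1, -1}" for e t
  proof -
    have *: "0 < 1 - t" "0 < 1 + t" "0 < t" and sq: "1 - t\<^sup>2 = (1 - t) * (1 + t)"
      using that(1) by (auto simp: algebra_simps power2_eq_square)
    have "\<bar>omega e t\<bar> \<le> 2 / ((1 - t) * (1 + t))"
      using * that by (auto simp: omega_def sq abs_mult divide_simps)
    also have "\<dots> \<le> 2 / (1 - t)" using * by (intro divide_left_mono) simp_all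
    finally show ?thesis .
  qed
  show "length (map omega es) \<noteq> 1"
    using adm by (auto simp: length_Suc_conv)
  show "\<bar>f t\<bar> \<le> 2 / (t * (1 - t))" if "f \<in> set (map omega es)" and t: "t \<in> {0<..<1}" for f t
  proof -
    from that(1) obtain e where "e \<in> set es" and e: "f = omega e" by auto
    hence "e \<in> {0, 1, -1}" using es by blast
    hence "\<bar>f t\<bar> \<le> 2 / t \<or> \<bar>f t\<bar> \<le> 2 / (1 - t)" using e w0[OF t] w1[OF t, of e] by auto
    moreover have "2 / t \<le> 2 / (t * (1 - t))" "2 / (1 - t) \<le> 2 / (t * (1 - t))"
      using t by (auto simp: divide_simps)
    ultimately show ?thesis by linarith
  qed
  show "\<bar>hd (map omega es) t\<bar> \<le> 2 / t" if "map omega es \<noteq> []" "t \<in> {0<..<1}" for t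
    using that adm w0 by (simp add: hd_map)
  show "\<bar>last (map omega es) t\<bar> \<le> 2 / (1 - t)" if "map omega es \<noteq> []" "t \<in> {0<..<1}" for t
  proof -
    have "last es \<in> {1, -1}" using that es adm last_in_set[of es] by blast
    thus ?thesis using that w1 by (simp add: last_map)
  qed
qed auto

theorem theorem1p2:
  fixes r :: nat and k l :: "nat \<Rightarrow> nat" and \<epsilon> :: "nat \<Rightarrow> int"
  assumes "\<And>i. i \<in> {1..r} \<Longrightarrow> k i > 0"
    and "\<And>i. i \<in> {1..r} \<Longrightarrow> l i > 0"
    and "\<And>i. i \<in> {1..r} \<Longrightarrow> \<epsilon> i \<in> {1, -1}"
  defines "lhs_word \<equiv>
      concat (map (\<lambda>i. replicate (k i) (omega 0) @ replicate (l i) (omega (\<epsilon> i)))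
        (rev [1..<Suc r]))"
    and "rhs_word \<equiv>
      concat (map (\<lambda>i. replicate (l i) (u_form (\<epsilon> i)) @ replicate (k i) (omega (-1)))
        [1..<Suc r])"
  shows "iterated_integrable lhs_word \<and> iterated_integrable rhs_word \<and>
         iterated_integral lhs_word = iterated_integral rhs_word"
proof -
  define es where "es = concat (map (\<lambda>i. replicate (k i) 0 @ replicate (l i) (\<epsilon> i)) (rev [1..<Suc r]))"
  have lhs: "lhs_word = map omega es"
    unfolding lhs_word_def es_def by (simp add: map_concat o_def)
  have "rev es = concat (map (\<lambda>i. replicate (l i) (\<epsilon> i) @ replicate (k i) 0) [1..<Suc r])"
    unfolding es_def by (simp only: rev_concat rev_map map_map rev_rev_ident o_def rev_append rev_replicate)
  moreover have "map dual_form \<dots> = rhs_word"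
    unfolding rhs_word_def map_concat map_map
  proof (intro arg_cong[where f = concat] map_cong refl)
    fix i assume "i \<in> set [1..<Suc r]"
    hence "\<epsilon> i \<noteq> 0" using assms(3)[of i] by auto
    thus "(map dual_form \<circ> (\<lambda>i. replicate (l i) (\<epsilon> i) @ replicate (k i) 0)) i =
        replicate (l i) (u_form (\<epsilon> i)) @ replicate (k i) (omega (- 1))"
      by (simp add: dual_form_def)
  qed
  ultimately have rhs: "rhs_word = map dual_form (rev es)" by simp
  have es: "set es \<subseteq> {0, 1, -1}"
    using assms(3) by (force simp: es_def)
  have "hd es = 0 \<and> last es \<noteq> 0" if "es \<noteq> []"
  proof -
    from that have r: "1 \<le> r" by (cases r) (auto simp: es_def)
    obtain r' where r': "r = Suc r'" using r by (cases r) auto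
    have "hd es = 0"
      using assms(1)[of r] r by (simp add: es_def r' hd_append)
    moreover have "last es = \<epsilon> 1"
    proof -
      have "[1..<Suc r] = 1 # [2..<Suc r]" using r by (simp add: upt_conv_Cons numeral_2_eq_2)
      thus ?thesis using assms(2)[of 1] r by (simp add: es_def last_append del: upt_Suc)
    qed
    ultimately show ?thesis using assms(3)[of 1] r by auto
  qed
  from iterated_integrable_omega[OF es this] iterated_duality[OF es] lhs rhs
  show ?thesis by simp
qed

end
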